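(* If $G$ is an exponential greedy numeration system, then its carry propagation $\mathsf{CP}_G$ exists.
   Context: A greedy numeration system (GNS) is given by a basis $G=(G_\ell)_{\ell\in\mathbb{N}}$, a strictly increasing sequence of integers with $G_0=1$. It is exponential if there exist real constants $\alpha>1$ and $C>0$ such that $G_\ell\sim C\alpha^\ell$ as $\ell\to\infty$. The greedy $G$-expansion of an integer $N\geq1$: let $k$ be such that $G_k\le N<G_{k+1}$; let $x_k$ and $r_k$ be the quotient and remainder of the Euclidean division of $N$ by $G_k$; for $i=k-1,\ldots,0$ let $x_i$ and $r_i$ be the quotient and remainder of the division of $r_{i+1}$ by $G_i$. Then $\langle N\rangle_G=x_kx_{k-1}\cdots x_0$; also $\langle 0\rangle_G=\varepsilon$ (the empty word). For words $u,v$: if $|u|=|v|$, $\Delta(u,v)$ is $|u|$ minus the length of the longest common prefix of $u$ and $v$; if $|u|\neq|v|$, $\Delta(u,v)=\max(|u|,|v|)$. The carry propagation at $i\in\mathbb{N}$ is $\mathsf{cp}_G(i)=\Delta(\langle i\rangle_G,\langle i+1\rangle_G)$, and the carry propagation of $G$ is the (finite) limit, if it exists, $\mathsf{CP}_G=\lim_{N\to\infty}\frac1N\sum_{i=0}^{N-1}\mathsf{cp}_G(i)$. *)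

theory Defs
  imports Complex_Main "HOL-Library.Landau_Symbols" "HOL-Library.Sublist"
begin

definition gns_basis :: "(nat \<Rightarrow> nat) \<Rightarrow> bool" where
  "gns_basis G \<longleftrightarrow> strict_mono G \<and> G 0 = 1"

definition exponential :: "(nat \<Rightarrow> nat) \<Rightarrow> bool" where
  "exponential G \<longleftrightarrow>
     (\<exists>(\<alpha>::real) (C::real). \<alpha> > 1 \<and> C > 0 \<and>
        (\<lambda>l. real (G l)) \<sim>[at_top] (\<lambda>l. C * \<alpha> ^ l))"

text \<open>
  Words are lists of digits with the most significant digit first.
  \<open>greedy_digits G n r\<close> produces the \<open>n\<close> digits at positions \<open>n - 1, \<dots>, 0\<close>
  by successive Euclidean divisions of the current remainder \<open>r\<close>.
\<close>

primrec greedy_digits :: "(nat \<Rightarrow> nat) \<Rightarrow> nat \<Rightarrow> nat \<Rightarrow> nat list" where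
  "greedy_digits G 0 r = []"
| "greedy_digits G (Suc i) r = (r div G i) # greedy_digits G i (r mod G i)"

text \<open>For a basis \<open>G\<close> and \<open>N \<ge> 1\<close>, the index \<open>k\<close> below exists and is unique.\<close>

definition greedy_expansion :: "(nat \<Rightarrow> nat) \<Rightarrow> nat \<Rightarrow> nat list" where
  "greedy_expansion G N =
     (if N = 0 then []
      else greedy_digits G (Suc (THE k. G k \<le> N \<and> N < G (Suc k))) N)"

definition word_delta :: "'a list \<Rightarrow> 'a list \<Rightarrow> nat" where
  "word_delta u v =
     (if length u = length v then length u - length (longest_common_prefix u v)
      else max (length u) (length v))"

definition cp :: "(nat \<Rightarrow> nat) \<Rightarrow> nat \<Rightarrow> nat" where
  "cp G i = word_delta (greedy_expansion G i) (greedy_expansion G (i + 1))"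

text \<open>\<open>has_carry_propagation G c\<close>: the limit defining the carry propagation of \<open>G\<close>
  exists and equals the real number \<open>c\<close>.\<close>

definition has_carry_propagation :: "(nat \<Rightarrow> nat) \<Rightarrow> real \<Rightarrow> bool" where
  "has_carry_propagation G c \<longleftrightarrow>
     (\<lambda>N. (\<Sum>i<N. real (cp G i)) / real N) \<longlonglongrightarrow> c"

end

theory Submission
  imports Defs "HOL-Analysis.Infinite_Products"
begin

text \<open>
  Let \<open>F N\<close> be the sum of the first \<open>N\<close> carry propagations, so that the limit of \<open>F N / N\<close> is wanted.
  The increment from \<open>i\<close> to \<open>i + 1\<close> changes the same digits as the increment from
  \<open>i mod G k\<close>, as long as \<open>i + 1 < G (Suc k)\<close> (lemma \<open>cp_mod\<close>). Hence \<open>F\<close> is determined by its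
  values on the basis: \<open>F N\<close> is exactly the sum of \<open>x\<^sub>i * F (G i)\<close>, where the \<open>x\<^sub>i\<close> are the greedy
  digits of \<open>N\<close>. So \<open>F N / N\<close> is the weighted average of the numbers \<open>u i = F (G i) / G i\<close> with
  weights \<open>x\<^sub>i * G i / N\<close>, and it suffices that \<open>u\<close> converges (\<open>mean_tendsto_of_basis_tendsto\<close>).

  Applied to \<open>N = G n - 1\<close>, the same formula says that \<open>u n\<close> is, up to an error of order
  \<open>n / G n\<close>, a weighted average of \<open>u 0, \<dots>, u (n - 1)\<close>. As these errors are summable, \<open>u\<close> is
  bounded. Averages of earlier terms may still oscillate in general. They do not here, because
  the terms before an index \<open>k\<close> contribute to \<open>u (k + s)\<close> only through the remainder of
  \<open>G (k + s) - 1\<close> after the digits at positions at least \<open>k\<close>. This remainder is less than \<open>G k\<close>, so the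
  total weight of those terms is at most about \<open>G k / G (k + s)\<close>, which is at most \<open>q ^ s\<close> for some
  \<open>q < 1\<close> and all large \<open>k\<close>. Now suppose that \<open>u\<close> eventually stays above \<open>a\<close>, and that \<open>u k\<close>
  exceeds \<open>a\<close> by \<open>\<eta>\<close> for some late \<open>k\<close>. Each later index \<open>k + s\<close> loses at most a fraction
  \<open>q ^ s\<close> of that excess, up to errors that are small when \<open>k\<close> is large, so a fraction of at least the infinite product of the
  \<open>1 - q ^ s\<close>, \<open>s \<ge> 1\<close>, survives forever. This product is positive, so the eventual lower
  bound \<open>a\<close> can be raised by an amount that depends on \<open>\<eta>\<close> only (\<open>lower_bounds_improve\<close>). A
  gap between the lower and the upper limit of \<open>u\<close> would contradict this
  (\<open>convergent_if_lower_bounds_improve\<close>).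

  If \<open>G l\<close> is asymptotic to \<open>C * \<alpha> ^ l\<close>, any \<open>q\<close> strictly between \<open>1 / \<alpha>\<close> and \<open>1\<close> serves, since the
  ratios \<open>G k / G (k + 1)\<close> tend to \<open>1 / \<alpha>\<close>.
\<close>

section \<open>The carry propagation as a sum over blocks\<close>

lemma length_greedy_digits [simp]: "length (greedy_digits G n r) = n"
  by (induction n arbitrary: r) auto

lemma word_delta_Cons:
  assumes "length u = length v"
  shows "word_delta (x # u) (y # v) = (if x = y then word_delta u v else Suc (length u))"
  using assms by (auto simp: word_delta_def)

text \<open>
  Leading zeros, filling both expansions up to \<open>k\<close> digits, make the two words equally long, so that the
  second clause of \<open>word_delta\<close> never applies.
\<close>

definition padded_delta :: "(nat \<Rightarrow> nat) \<Rightarrow> nat \<Rightarrow> nat \<Rightarrow> nat" where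
  "padded_delta G k i = word_delta (greedy_digits G k i) (greedy_digits G k (i + 1))"

lemma padded_delta_Suc:
  "padded_delta G (Suc k) i =
     (if i div G k = (i + 1) div G k
      then word_delta (greedy_digits G k (i mod G k)) (greedy_digits G k ((i + 1) mod G k))
      else Suc k)"
  by (simp add: padded_delta_def word_delta_Cons)

lemma padded_delta_mono:
  assumes "mono G" "i + 1 < G k" "k \<le> l"
  shows "padded_delta G l i = padded_delta G k i"
  using assms(3)
proof (induction l rule: dec_induct)
  case (step l)
  have "i + 1 < G l"
    using assms(1,2) step.hyps(1) by (meson le_trans monoD not_less)
  then show ?case
    using step.IH by (simp add: padded_delta_Suc) (simp add: padded_delta_def)
qed simp

lemma basis_mono: "gns_basis G \<Longrightarrow> mono G"
  by (simp add: gns_basis_def strict_mono_mono)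

lemma basis_pos: "gns_basis G \<Longrightarrow> 0 < G k"
  by (metis gns_basis_def le0 less_le_trans less_one strict_mono_less_eq)

lemma basis_interval_exists:
  assumes "gns_basis G" "0 < N"
  obtains k where "G k \<le> N" "N < G (Suc k)"
proof -
  have sm: "strict_mono G" and G0: "G 0 = 1"
    using assms(1) by (auto simp: gns_basis_def)
  have "N < G (Suc N)"
    using strict_mono_imp_increasing[OF sm, of "Suc N"] by simp
  then obtain k where "\<not> N < G k" "N < G (Suc k)"
    using ex_least_nat_less[of "\<lambda>k. N < G k" "Suc N"] G0 assms(2) by auto
  then show thesis
    using that[of k] by simp
qed

lemma greedy_expansion_eq:
  assumes "gns_basis G" "G k \<le> N" "N < G (Suc k)"
  shows "greedy_expansion G N = greedy_digits G (Suc k) N"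
proof -
  have sm: "strict_mono G"
    using assms(1) by (auto simp: gns_basis_def)
  have "j = k" if "G j \<le> N \<and> N < G (Suc j)" for j
    using that assms(2,3) strict_mono_less[OF sm]
    by (metis le_less_trans less_Suc_eq nat_neq_iff not_less_eq)
  then have "(THE j. G j \<le> N \<and> N < G (Suc j)) = k"
    using assms(2,3) by blast
  moreover have "N \<noteq> 0"
    using basis_pos[OF assms(1), of k] assms(2) by simp
  ultimately show ?thesis
    by (simp add: greedy_expansion_def)
qed

text \<open>
  When \<open>i + 1\<close> has one digit more than \<open>i\<close>, that is, when \<open>i + 1 = G m\<close>, the maximum of the lengths
  is \<open>m + 1\<close>; the padded words first differ at position \<open>m\<close>, where \<open>0\<close> becomes \<open>1\<close>, which counts the same. In all other
  cases both expansions have equal length and padding adds to their common prefix only.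
\<close>

lemma cp_eq_padded_delta:
  assumes basis: "gns_basis G" and "i + 1 < G k"
  shows "cp G i = padded_delta G k i"
proof -
  obtain m where m: "G m \<le> i + 1" "i + 1 < G (Suc m)"
    using basis_interval_exists[OF basis, of "i + 1"] by auto
  have Suc_exp: "greedy_expansion G (i + 1) = greedy_digits G (Suc m) (i + 1)"
    using greedy_expansion_eq[OF basis m] .
  have "cp G i = padded_delta G (Suc m) i"
  proof (cases "G m \<le> i")
    case True
    then show ?thesis
      using greedy_expansion_eq[OF basis, of m i] m Suc_exp
      by (simp add: cp_def padded_delta_def)
  next
    case False
    then have i: "i + 1 = G m"
      using m by simp
    have "length (greedy_expansion G i) < Suc m"
    proof (cases "i = 0")
      case True
      then show ?thesis by (simp add: greedy_expansion_def)
    next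
      case False
      then obtain n where n: "G n \<le> i" "i < G (Suc n)"
        using basis_interval_exists[OF basis, of i] by auto
      have "n < m"
        using n(1) i basis by (metis gns_basis_def less_add_one le_less_trans strict_mono_less)
      then show ?thesis
        using greedy_expansion_eq[OF basis n] by simp
    qed
    then have "cp G i = Suc m"
      unfolding cp_def Suc_exp word_delta_def by (simp del: greedy_digits.simps)
    moreover have "padded_delta G (Suc m) i = Suc m"
      using i by (auto simp: padded_delta_Suc)
    ultimately show ?thesis by simp
  qed
  also have "\<dots> = padded_delta G k i"
    using padded_delta_mono[OF basis_mono[OF basis]] m(2) assms(2)
    by (metis linear)
  finally show ?thesis .
qed

lemma cp_block_end:
  assumes basis: "gns_basis G" and "i + 1 < G (Suc k)" "(i + 1) mod G k = 0"
  shows "cp G i = Suc k"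
proof -
  have "i div G k \<noteq> (i + 1) div G k"
    using assms(3) by (metis Suc_eq_plus1 div_Suc n_not_Suc_n)
  then show ?thesis
    using cp_eq_padded_delta[OF basis assms(2)] by (simp add: padded_delta_Suc)
qed

text \<open>
  Within a block of length \<open>G k\<close> the digit at position \<open>k\<close> is constant and the lower digits run
  through the expansions of the numbers below \<open>G k\<close>. At the end of a block the digit at position \<open>k\<close>
  changes, which costs \<open>k + 1\<close>, and so does the increment from \<open>G k - 1\<close> to \<open>G k\<close>. This agreement
  makes the block decomposition of the sum exact, without an error term.
\<close>

lemma cp_mod:
  assumes basis: "gns_basis G" and i: "i + 1 < G (Suc k)"
  shows "cp G i = cp G (i mod G k)"
proof (cases "(i + 1) mod G k = 0")
  case True
  have pos: "0 < G k"
    using basis_pos[OF basis] .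
  have "i mod G k + 1 = G k"
    using True pos by (simp add: mod_Suc split: if_splits)
  then have "cp G (i mod G k) = Suc k"
    using basis by (intro cp_block_end) (auto simp: gns_basis_def strict_mono_def)
  then show ?thesis
    using cp_block_end[OF basis i True] by simp
next
  case False
  then have mod: "(i + 1) mod G k = i mod G k + 1"
    by (auto simp: mod_Suc split: if_splits)
  have "(i + 1) div G k = i div G k"
    using False by (simp add: div_Suc)
  then have "cp G i = padded_delta G k (i mod G k)"
    using cp_eq_padded_delta[OF basis i] mod
    by (simp add: padded_delta_Suc) (simp add: padded_delta_def)
  moreover have "i mod G k + 1 < G k"
    using mod basis_pos[OF basis, of k] by (metis mod_less_divisor)
  ultimately show ?thesis
    using cp_eq_padded_delta[OF basis] by simp
qed

lemma sum_mod_periodic: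
  fixes f :: "nat \<Rightarrow> real"
  assumes "0 < m"
  shows "(\<Sum>i<N. f (i mod m)) = real (N div m) * (\<Sum>i<m. f i) + (\<Sum>i<N mod m. f i)"
proof (induction N)
  case (Suc N)
  show ?case
  proof (cases "Suc (N mod m) = m")
    case True
    then have "(\<Sum>i<m. f i) = (\<Sum>i<N mod m. f i) + f (N mod m)"
      by (metis sum.lessThan_Suc)
    then show ?thesis
      using True Suc.IH by (simp add: mod_Suc div_Suc algebra_simps)
  next
    case False
    then show ?thesis
      using Suc.IH by (auto simp: mod_Suc div_Suc)
  qed
qed simp

text \<open>
  Iterated, the equation says that \<open>F N\<close> is the sum of \<open>x\<^sub>i * F (G i)\<close> over the greedy digits
  \<open>x\<^sub>i\<close> of \<open>N\<close>. The single division step is the form in which it is used in inductions.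
\<close>

definition greedy_additive :: "(nat \<Rightarrow> nat) \<Rightarrow> (nat \<Rightarrow> real) \<Rightarrow> bool" where
  "greedy_additive G F \<longleftrightarrow>
     (\<forall>k N. N < G (Suc k) \<longrightarrow> F N = real (N div G k) * F (G k) + F (N mod G k))"

lemma greedy_additive_zero:
  assumes "gns_basis G" "greedy_additive G F"
  shows "F 0 = 0"
proof -
  have G0: "G 0 = 1"
    using assms(1) by (simp add: gns_basis_def)
  moreover have "G 0 < G (Suc 0)"
    using assms(1) unfolding gns_basis_def by (meson lessI strict_mono_less)
  ultimately have "F 1 = real (1 div G 0) * F (G 0) + F (1 mod G 0)"
    using assms(2)[unfolded greedy_additive_def, rule_format, of 1 0] by simp
  then show ?thesis
    by (simp add: G0)
qed

lemma greedy_additive_sum_cp: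
  assumes "gns_basis G"
  shows "greedy_additive G (\<lambda>N. \<Sum>i<N. real (cp G i))"
  unfolding greedy_additive_def
proof (intro allI impI)
  fix k N assume N: "N < G (Suc k)"
  have "(\<Sum>i<N. real (cp G i)) = (\<Sum>i<N. real (cp G (i mod G k)))"
    using N cp_mod[OF assms] by (intro sum.cong) auto
  then show "(\<Sum>i<N. real (cp G i)) =
      real (N div G k) * (\<Sum>i<G k. real (cp G i)) + (\<Sum>i<N mod G k. real (cp G i))"
    using sum_mod_periodic[OF basis_pos[OF assms], of "\<lambda>i. real (cp G i)"] by simp
qed

section \<open>Additive functions and their values on the basis\<close>

text \<open>
  The digits of \<open>N\<close> at positions at least \<open>K\<close> represent \<open>N - r\<close>, where \<open>r\<close> is the remainder below
  \<open>G K\<close>; each of these digits contributes at least \<open>a\<close> times what it represents. Applied to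
  \<open>- F\<close> and \<open>- a\<close>, this also yields upper bounds.
\<close>

lemma greedy_additive_lower:
  assumes basis: "gns_basis G" and add: "greedy_additive G F"
    and low: "\<And>i. K \<le> i \<Longrightarrow> i < L \<Longrightarrow> a * real (G i) \<le> F (G i)"
    and "K \<le> L" "N < G L"
  shows "\<exists>r. r < G K \<and> r \<le> N \<and> a * (real N - real r) + F r \<le> F N"
  using assms(4,3,5)
proof (induction L arbitrary: N rule: dec_induct)
  case base
  then show ?case by auto
next
  case (step L)
  let ?x = "N div G L" and ?s = "N mod G L"
  have "?s < G L"
    using basis_pos[OF basis] by simp
  then obtain r where r: "r < G K" "r \<le> ?s" "a * (real ?s - real r) + F r \<le> F ?s"
    using step.IH[of ?s] step.prems(1) by (auto simp: less_Suc_eq)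
  have N: "real N = real ?x * real (G L) + real ?s"
    by (metis div_mult_mod_eq of_nat_add of_nat_mult)
  have "F N = real ?x * F (G L) + F ?s"
    using add step.prems(2) by (simp add: greedy_additive_def)
  also have "\<dots> \<ge> real ?x * (a * real (G L)) + (a * (real ?s - real r) + F r)"
    using step.prems(1)[of L] step.hyps r(3) by (intro add_mono mult_left_mono) auto
  finally have "a * (real N - real r) + F r \<le> F N"
    by (subst N) (simp add: algebra_simps)
  moreover have "r \<le> N"
    using r(2) by (meson le_trans mod_less_eq_dividend)
  ultimately show ?case
    using r(1) by blast
qed

lemma greedy_additive_uminus:
  "greedy_additive G F \<Longrightarrow> greedy_additive G (\<lambda>n. - F n)"
  by (simp add: greedy_additive_def)

text \<open>
  The remainder \<open>r\<close> of the previous lemma takes finitely many values, so its effect is a constant.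
\<close>

lemma greedy_additive_eventually_lower:
  assumes basis: "gns_basis G" and add: "greedy_additive G F"
    and low: "\<forall>\<^sub>F i in sequentially. a \<le> F (G i) / real (G i)"
  obtains C where "C \<ge> 0" "\<And>n. a * real n - C \<le> F n"
proof -
  obtain K where K: "\<And>i. K \<le> i \<Longrightarrow> a \<le> F (G i) / real (G i)"
    using low by (auto simp: eventually_sequentially)
  have low': "a * real (G i) \<le> F (G i)" if "K \<le> i" for i
    using K[OF that] basis_pos[OF basis, of i] by (simp add: field_simps)
  define C where "C = (\<Sum>r<G K. \<bar>F r - a * real r\<bar>)"
  have "a * real n - C \<le> F n" for n
  proof -
    have "strict_mono G"
      using basis by (simp add: gns_basis_def)
    then have "n < G (Suc (max K n))"
      using strict_mono_imp_increasing[of G "Suc (max K n)"] by linarith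
    then obtain r where r: "r < G K" "a * (real n - real r) + F r \<le> F n"
      using greedy_additive_lower[OF basis add low', of K "Suc (max K n)" n]
      by (meson le_SucI max.cobounded1)
    have "\<bar>F r - a * real r\<bar> \<le> C"
      unfolding C_def using r(1) by (intro member_le_sum) auto
    then show ?thesis
      using r(2) by (simp add: algebra_simps)
  qed
  moreover have "C \<ge> 0"
    by (simp add: C_def sum_nonneg)
  ultimately show thesis
    using that by blast
qed

lemma mean_tendsto_of_basis_tendsto:
  assumes basis: "gns_basis G" and add: "greedy_additive G F"
    and lim: "(\<lambda>i. F (G i) / real (G i)) \<longlonglongrightarrow> d"
  shows "(\<lambda>N. F N / real N) \<longlonglongrightarrow> d"
proof (rule LIMSEQ_I)
  fix e :: real assume "e > 0"
  then have e2: "e / 2 > 0" by simp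
  have "\<forall>\<^sub>F i in sequentially. d - e / 2 < F (G i) / real (G i)"
    using order_tendstoD(1)[OF lim] e2 by simp
  then have "\<forall>\<^sub>F i in sequentially. d - e / 2 \<le> F (G i) / real (G i)"
    by (rule eventually_mono) simp
  then obtain C where C: "C \<ge> 0" "\<And>n. (d - e / 2) * real n - C \<le> F n"
    using greedy_additive_eventually_lower[OF basis add] by metis
  have "\<forall>\<^sub>F i in sequentially. F (G i) / real (G i) < d + e / 2"
    using order_tendstoD(2)[OF lim] e2 by simp
  then have "\<forall>\<^sub>F i in sequentially. - (d + e / 2) \<le> - F (G i) / real (G i)"
    by (rule eventually_mono) simp
  then obtain D where D: "D \<ge> 0" "\<And>n. - (d + e / 2) * real n - D \<le> - F n"
    using greedy_additive_eventually_lower[OF basis greedy_additive_uminus[OF add]]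
    by metis
  obtain M where M: "2 * (C + D) / e < real M"
    using reals_Archimedean2 by blast
  have "norm (F n / real n - d) < e" if n: "Suc M \<le> n" for n
  proof -
    have "2 * (C + D) / e < real n" and n0: "0 < real n"
      using M n by auto
    then have "C + D < e / 2 * real n"
      using \<open>e > 0\<close> by (simp add: field_simps)
    then have "\<bar>F n - d * real n\<bar> < e * real n"
      using C(1) C(2)[of n] D(1) D(2)[of n] by (simp add: algebra_simps abs_less_iff)
    moreover have "F n / real n - d = (F n - d * real n) / real n"
      using n0 by (simp add: field_simps)
    ultimately show ?thesis
      using n0 by (simp add: abs_divide divide_less_eq)
  qed
  then show "\<exists>N0. \<forall>n\<ge>N0. norm (F n / real n - d) < e"
    by blast
qed

section \<open>Convergence along the basis\<close>

text \<open>
  The limit is the supremum \<open>m\<close> of all eventual lower bounds. If \<open>u\<close> came back above some \<open>b > m\<close>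
  infinitely often, the eventual lower bound \<open>m - \<delta> / 2\<close> could be raised by \<open>\<delta>\<close>, beyond \<open>m\<close>. It is
  essential that \<open>\<delta>\<close> does not depend on the lower bound.
\<close>

lemma convergent_if_lower_bounds_improve:
  fixes u :: "nat \<Rightarrow> real"
  assumes bounds: "\<And>i. l \<le> u i" "\<And>i. u i \<le> B"
    and improve: "\<And>\<eta>. \<eta> > 0 \<Longrightarrow> \<exists>\<delta>>0. \<forall>a. (\<forall>\<^sub>F i in sequentially. a \<le> u i) \<longrightarrow>
      (\<exists>\<^sub>F i in sequentially. a + \<eta> \<le> u i) \<longrightarrow> (\<forall>\<^sub>F i in sequentially. a + \<delta> \<le> u i)"
  shows "convergent u"
proof -
  define S where "S = {a. \<forall>\<^sub>F i in sequentially. a \<le> u i}"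
  define m where "m = Sup S"
  have "l \<in> S"
    using bounds(1) by (simp add: S_def)
  have "a \<le> B" if "a \<in> S" for a
  proof -
    obtain i where "a \<le> u i"
      using \<open>a \<in> S\<close> by (auto simp: S_def eventually_sequentially)
    then show ?thesis
      using bounds(2)[of i] by simp
  qed
  then have bdd: "bdd_above S"
    by (auto simp: bdd_above_def)
  have below: "\<forall>\<^sub>F i in sequentially. a \<le> u i" if "a < m" for a
  proof -
    obtain b where "b \<in> S" "a < b"
      using \<open>a < m\<close> \<open>l \<in> S\<close> bdd less_cSup_iff[of S a] by (auto simp: m_def)
    then show ?thesis
      by (auto simp: S_def elim!: eventually_mono)
  qed
  have "u \<longlonglongrightarrow> m"
  proof (rule order_tendstoI)
    fix a assume "a < m"
    then have "\<forall>\<^sub>F i in sequentially. (a + m) / 2 \<le> u i"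
      by (intro below) simp
    then show "\<forall>\<^sub>F i in sequentially. a < u i"
      by (rule eventually_mono) (use \<open>a < m\<close> in \<open>simp add: field_simps\<close>)
  next
    fix b assume "m < b"
    then obtain \<delta> where "\<delta> > 0"
      and \<delta>: "\<And>a. \<lbrakk>\<forall>\<^sub>F i in sequentially. a \<le> u i; \<exists>\<^sub>F i in sequentially. a + (b - m) \<le> u i\<rbrakk>
        \<Longrightarrow> \<forall>\<^sub>F i in sequentially. a + \<delta> \<le> u i"
      using improve[of "b - m"] by auto
    show "\<forall>\<^sub>F i in sequentially. u i < b"
    proof (rule ccontr)
      assume "\<not> ?thesis"
      then have "\<exists>\<^sub>F i in sequentially. b \<le> u i"
        by (simp add: not_eventually not_less)
      then have "\<exists>\<^sub>F i in sequentially. (m - \<delta> / 2) + (b - m) \<le> u i"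
        by (rule frequently_elim1) (use \<open>\<delta> > 0\<close> in simp)
      then have "\<forall>\<^sub>F i in sequentially. (m - \<delta> / 2) + \<delta> \<le> u i"
        by (intro \<delta> below) (use \<open>\<delta> > 0\<close> in simp)
      then have "(m - \<delta> / 2) + \<delta> \<in> S"
        by (simp add: S_def)
      then have "(m - \<delta> / 2) + \<delta> \<le> m"
        using cSup_upper[OF _ bdd] unfolding m_def by blast
      then show False
        using \<open>\<delta> > 0\<close> by simp
    qed
  qed
  then show ?thesis
    by (rule convergentI)
qed

text \<open>
  The products decrease to their infinite product, which is nonzero since the powers of \<open>q\<close> are
  summable.
\<close>

lemma euler_products_bounded_below:
  fixes q :: real
  assumes "0 < q" "q < 1"
  obtains P where "0 < P" "\<And>n. P \<le> (\<Prod>i<n. 1 - q ^ Suc i)"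
proof -
  let ?f = "\<lambda>i. 1 - q ^ Suc i"
  have f01: "0 < ?f i" "?f i \<le> 1" for i
    using assms by (auto simp del: power_Suc intro!: power_Suc_less_one)
  have "summable (\<lambda>i. norm (?f i - 1))"
    using assms by (simp add: summable_mult power_abs summable_geometric abs_mult)
  then have conv: "convergent_prod ?f"
    by (intro abs_convergent_prod_imp_convergent_prod)
      (simp add: abs_convergent_prod_conv_summable del: power_Suc)
  have dec: "prod ?f {..<n} \<le> prod ?f {..<N}" if "N \<le> n" for N n
    using that
  proof (induction n rule: dec_induct)
    case (step n)
    have "0 \<le> prod ?f {..<n}"
      using f01 less_imp_le by (intro prod_nonneg) blast
    then have "prod ?f {..<Suc n} \<le> prod ?f {..<n}"
      using f01(2)[of n] by (simp add: mult_left_le del: power_Suc)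
    then show ?case
      using step.IH by linarith
  qed simp
  show thesis
  proof (rule that)
    show "0 < prodinf ?f"
      using less_0_prodinf[OF conv] f01 by blast
    show "prodinf ?f \<le> prod ?f {..<n}" for n
      using prodinf_le_const[OF conv dec, of n] by simp
  qed
qed

lemma ratio_bound_iterate:
  fixes g :: "nat \<Rightarrow> real"
  assumes "\<And>k. K \<le> k \<Longrightarrow> g k \<le> q * g (Suc k)" "0 \<le> q" "K \<le> k"
  shows "g k \<le> q ^ s * g (k + s)"
proof (induction s)
  case (Suc s)
  have "g k \<le> q ^ s * g (k + s)"
    using Suc.IH .
  also have "\<dots> \<le> q ^ s * (q * g (Suc (k + s)))"
    using assms by (intro mult_left_mono) auto
  finally show ?case
    by (simp add: algebra_simps)
qed simp

text \<open>
  The loss of excess is followed from one index to the next. Let \<open>\<rho> s\<close> be the excess over \<open>a\<close>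
  guaranteed at the indices \<open>k, \<dots>, k + s\<close>. At \<open>k + s + 1\<close> all but a part \<open>q ^ (s + 1)\<close> of the weight
  lies on these indices. The rest of the weight has no excess, and its deficit is bounded by a constant, which is
  at most \<open>e * G k\<close> when \<open>k\<close> is large. The recursion
  \<open>\<rho> (s + 1) = \<rho> s * (1 - q ^ (s + 1)) - e * q ^ (s + 1)\<close> is
  multiplicative in \<open>\<rho> + e\<close>, which gives the closed form used in the proof.
\<close>

lemma lower_bounds_improve:
  assumes basis: "gns_basis G" and add: "greedy_additive G F" and mono: "mono F"
    and q: "0 < q" "q < 1"
    and ratio: "\<forall>\<^sub>F k in sequentially. real (G k) \<le> q * real (G (Suc k))"
    and "\<eta> > 0"
  shows "\<exists>\<delta>>0. \<forall>a. (\<forall>\<^sub>F i in sequentially. a \<le> F (G i) / real (G i)) \<longrightarrow>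
    (\<exists>\<^sub>F i in sequentially. a + \<eta> \<le> F (G i) / real (G i)) \<longrightarrow>
    (\<forall>\<^sub>F i in sequentially. a + \<delta> \<le> F (G i) / real (G i))"
proof -
  obtain P where P: "0 < P" and P_le: "\<And>n. P \<le> (\<Prod>i<n. 1 - q ^ Suc i)"
    using euler_products_bounded_below[OF q] by blast
  \<comment> \<open>Half of the surviving excess \<open>\<eta> * P\<close> pays for the error terms, half remains as improvement.\<close>
  define e where "e = \<eta> * P / 2"
  have "e > 0"
    using \<open>\<eta> > 0\<close> P by (simp add: e_def)
  obtain K0 where K0: "\<And>k. K0 \<le> k \<Longrightarrow> real (G k) \<le> q * real (G (Suc k))"
    using ratio by (auto simp: eventually_sequentially)
  have sm: "strict_mono G"
    using basis by (simp add: gns_basis_def)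
  have Gpos: "0 < real (G k)" for k
    using basis_pos[OF basis] by simp
  have "\<forall>\<^sub>F i in sequentially. a + e \<le> F (G i) / real (G i)"
    if low: "\<forall>\<^sub>F i in sequentially. a \<le> F (G i) / real (G i)"
      and freq: "\<exists>\<^sub>F i in sequentially. a + \<eta> \<le> F (G i) / real (G i)" for a
  proof -
    obtain C where C: "C \<ge> 0" "\<And>n. a * real n - C \<le> F n"
      using greedy_additive_eventually_lower[OF basis add low] by blast
    have "filterlim (\<lambda>k. e * real (G k)) at_top sequentially"
      using filterlim_tendsto_pos_mult_at_top[OF tendsto_const \<open>e > 0\<close>
          filterlim_compose[OF filterlim_real_sequentially filterlim_subseq[OF sm]]] .
    then have "\<forall>\<^sub>F k in sequentially. \<bar>a\<bar> + C \<le> e * real (G k)"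
      by (simp add: filterlim_at_top)
    then have "\<exists>\<^sub>F k in sequentially. a + \<eta> \<le> F (G k) / real (G k) \<and>
        (\<bar>a\<bar> + C \<le> e * real (G k) \<and> K0 \<le> k)"
      using freq eventually_ge_at_top[of K0]
      by (intro frequently_eventually_frequently eventually_conj) auto
    then obtain k where k: "a + \<eta> \<le> F (G k) / real (G k)" "\<bar>a\<bar> + C \<le> e * real (G k)" "K0 \<le> k"
      using frequently_ex by blast
    define \<rho> where "\<rho> s = (\<eta> + e) * (\<Prod>i<s. 1 - q ^ Suc i) - e" for s
    have \<rho>_ge: "e \<le> \<rho> s" for s
    proof -
      have "(\<eta> + e) * P \<le> (\<eta> + e) * (\<Prod>i<s. 1 - q ^ Suc i)"
        using P_le \<open>\<eta> > 0\<close> \<open>e > 0\<close> by (intro mult_left_mono) auto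
      moreover have "2 * e \<le> (\<eta> + e) * P"
        using \<open>e > 0\<close> P by (simp add: e_def algebra_simps)
      ultimately show ?thesis
        by (simp add: \<rho>_def)
    qed
    have \<rho>_Suc: "\<rho> (Suc s) = \<rho> s * (1 - q ^ Suc s) - e * q ^ Suc s" for s
      by (simp add: \<rho>_def algebra_simps)
    have "\<rho> (Suc s) \<le> \<rho> s" for s
    proof -
      have "0 \<le> q ^ Suc s" "0 \<le> \<rho> s"
        using q \<open>e > 0\<close> \<rho>_ge[of s] by auto
      then have "0 \<le> \<rho> s * q ^ Suc s" "0 \<le> e * q ^ Suc s"
        using \<open>e > 0\<close> by (auto intro!: mult_nonneg_nonneg)
      then show ?thesis
        unfolding \<rho>_Suc by (simp add: algebra_simps)
    qed
    then have \<rho>_anti: "\<rho> t \<le> \<rho> s" if "s \<le> t" for s t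
      using lift_Suc_antimono_le[of \<rho> s t] that by blast
    have main: "(a + \<rho> s) * real (G (k + s)) \<le> F (G (k + s))" for s
    proof (induction s rule: less_induct)
      case (less s)
      show ?case
      proof (cases s)
        case 0
        then show ?thesis
          using k(1) Gpos[of k] by (simp add: \<rho>_def field_simps)
      next
        case (Suc t)
        \<comment> \<open>The step down to \<open>G (k + s) - 1\<close> is needed because only numbers below \<open>G (k + s)\<close>
          decompose into smaller basis elements; monotonicity of \<open>F\<close> makes up for it.\<close>
        define g N where "g = real (G (k + s))" and "N = G (k + s) - 1"
        have N: "real N = g - 1" "N < G (k + s)"
          using basis_pos[OF basis, of "k + s"] by (auto simp: N_def g_def)
        have "(a + \<rho> t) * real (G i) \<le> F (G i)" if "k \<le> i" "i < k + s" for i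
        proof -
          have "(a + \<rho> t) * real (G i) \<le> (a + \<rho> (i - k)) * real (G i)"
            using \<rho>_anti[of "i - k" t] that Suc by (intro mult_right_mono) auto
          also have "\<dots> \<le> F (G i)"
            using less.IH[of "i - k"] that by simp
          finally show ?thesis .
        qed
        then obtain r where r: "r < G k" "(a + \<rho> t) * (real N - real r) + F r \<le> F N"
          using greedy_additive_lower[OF basis add, of k "k + s" "a + \<rho> t" N] N(2) by auto
        have Gk: "real (G k) \<le> q ^ s * g"
          using ratio_bound_iterate[of K0 "\<lambda>k. real (G k)" q k s] K0 q k(3) by (simp add: g_def)
        have "a + C \<le> e * (q ^ s * g)"
          using k(2) Gk \<open>e > 0\<close> mult_left_mono[OF Gk, of e] by linarith
        moreover have "\<rho> t * (g - q ^ s * g) \<le> \<rho> t * (real N - real r)"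
          using N(1) r(1) Gk \<rho>_ge[of t] \<open>e > 0\<close> by (intro mult_left_mono) auto
        moreover have "(a + \<rho> s) * g = a * g + \<rho> t * (g - q ^ s * g) - e * (q ^ s * g)"
          unfolding Suc \<rho>_Suc by (simp add: algebra_simps)
        moreover have "(a + \<rho> t) * (real N - real r) = a * g - a - a * real r + \<rho> t * (real N - real r)"
          unfolding N(1) by (simp add: algebra_simps)
        ultimately have "(a + \<rho> s) * g \<le> F N"
          using r(2) C(2)[of r] by linarith
        also have "F N \<le> F (G (k + s))"
          using mono by (auto simp: N_def mono_def)
        finally show ?thesis
          by (simp add: g_def)
      qed
    qed
    have "a + e \<le> F (G i) / real (G i)" if "k \<le> i" for i
    proof -
      have "(a + e) * real (G i) \<le> (a + \<rho> (i - k)) * real (G i)"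
        using \<rho>_ge by (intro mult_right_mono) auto
      also have "\<dots> \<le> F (G i)"
        using main[of "i - k"] that by simp
      finally show ?thesis
        using Gpos[of i] by (simp add: field_simps)
    qed
    then show ?thesis
      by (auto simp: eventually_sequentially)
  qed
  then show ?thesis
    using \<open>e > 0\<close> by blast
qed

text \<open>
  An upper bound \<open>b\<close> for the means at the indices below \<open>k\<close> carries over to \<open>G k - 1\<close>, so the bound
  grows by at most \<open>(k + 1) / G k\<close> at the index \<open>k\<close>. After a shift of the index, these increments
  are dominated by a multiple of \<open>(n + 1) * q ^ n\<close> and hence summable.
\<close>

lemma basis_means_bounded:
  assumes basis: "gns_basis G" and add: "greedy_additive G F"
    and jump: "\<And>k. F (G k) \<le> F (G k - 1) + real (Suc k)"
    and q: "0 < q" "q < 1"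
    and ratio: "\<forall>\<^sub>F k in sequentially. real (G k) \<le> q * real (G (Suc k))"
  obtains B where "\<And>k. F (G k) \<le> B * real (G k)"
proof -
  have Gpos: "0 < real (G k)" for k
    using basis_pos[OF basis] by simp
  have G0: "G 0 = 1"
    using basis by (simp add: gns_basis_def)
  have F0: "F 0 = 0"
    using greedy_additive_zero[OF basis add] .
  obtain K where K: "\<And>k. K \<le> k \<Longrightarrow> real (G k) \<le> q * real (G (Suc k))"
    using ratio by (auto simp: eventually_sequentially)
  have "summable (\<lambda>k. real (Suc (k + K)) / real (G (k + K)))"
  proof (rule summable_comparison_test)
    have "summable (\<lambda>n. real (Suc n) * q ^ n)"
      using sums_summable[OF geometric_deriv_sums[of q]] q by simp
    then show "summable (\<lambda>n. real (Suc K) * (real (Suc n) * q ^ n))"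
      by (rule summable_mult)
    have "real (Suc (n + K)) / real (G (n + K)) \<le> real (Suc K) * (real (Suc n) * q ^ n)" for n
    proof -
      have "1 \<le> real (G K)"
        using Gpos[of K] by simp
      also have "\<dots> \<le> q ^ n * real (G (n + K))"
        using ratio_bound_iterate[of K "\<lambda>k. real (G k)" q K n] K q by (simp add: add.commute)
      finally have "1 / real (G (n + K)) \<le> q ^ n"
        using Gpos[of "n + K"] by (simp add: field_simps)
      moreover have "real (Suc (n + K)) \<le> real (Suc K) * real (Suc n)"
        by (simp add: algebra_simps)
      ultimately have "real (Suc (n + K)) * (1 / real (G (n + K))) \<le> real (Suc K) * real (Suc n) * q ^ n"
        by (intro mult_mono) auto
      then show ?thesis
        by (simp add: mult.assoc)
    qed
    then show "\<exists>N. \<forall>n\<ge>N. norm (real (Suc (n + K)) / real (G (n + K)))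
        \<le> real (Suc K) * (real (Suc n) * q ^ n)"
      by auto
  qed
  then have summ: "summable (\<lambda>k. real (Suc k) / real (G k))"
    by (subst (asm) summable_iff_shift)
  define b where "b k = (\<Sum>i\<le>k. real (Suc i) / real (G i))" for k
  have b_mono: "b i \<le> b j" if "i \<le> j" for i j
    unfolding b_def using that by (intro sum_mono2) auto
  have main: "F (G k) \<le> b k * real (G k)" for k
  proof (induction k rule: less_induct)
    case (less k)
    show ?case
    proof (cases k)
      case 0
      then show ?thesis
        using jump[of 0] F0 by (simp add: b_def G0)
    next
      case (Suc j)
      have b0: "0 \<le> b j"
        unfolding b_def by (intro sum_nonneg) auto
      have "- b j * real (G i) \<le> - F (G i)" if "0 \<le> i" "i < k" for i
      proof -
        have "b i * real (G i) \<le> b j * real (G i)"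
          using b_mono[of i j] that Suc by (intro mult_right_mono) auto
        then show ?thesis
          using less.IH[OF that(2)] by simp
      qed
      then obtain r where "r < G 0"
        "- b j * (real (G k - 1) - real r) + - F r \<le> - F (G k - 1)"
        using greedy_additive_lower[OF basis greedy_additive_uminus[OF add], of 0 k "- b j" "G k - 1"]
          basis_pos[OF basis, of k] by auto
      then have "F (G k - 1) \<le> b j * real (G k - 1)"
        by (simp add: G0 F0)
      also have "\<dots> \<le> b j * real (G k)"
        using b0 by (intro mult_left_mono) auto
      finally have "F (G k) \<le> b j * real (G k) + real (Suc k)"
        using jump[of k] by simp
      also have "\<dots> = b k * real (G k)"
        using Gpos[of k] by (simp add: b_def Suc distrib_right del: of_nat_Suc)
      finally show ?thesis .
    qed
  qed
  show thesis
  proof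
    fix k
    have "b k \<le> (\<Sum>i. real (Suc i) / real (G i))"
      unfolding b_def by (intro sum_le_suminf summ) auto
    then show "F (G k) \<le> (\<Sum>i. real (Suc i) / real (G i)) * real (G k)"
      using main[of k] mult_right_mono[of "b k" _ "real (G k)"] by force
  qed
qed

lemma mean_converges_if_ratio_bounded:
  assumes basis: "gns_basis G" and add: "greedy_additive G F" and mono: "mono F"
    and jump: "\<And>k. F (G k) \<le> F (G k - 1) + real (Suc k)"
    and q: "0 < q" "q < 1"
    and ratio: "\<forall>\<^sub>F k in sequentially. real (G k) \<le> q * real (G (Suc k))"
  shows "convergent (\<lambda>N. F N / real N)"
proof -
  have Gpos: "0 < real (G k)" for k
    using basis_pos[OF basis] by simp
  obtain B where B: "\<And>k. F (G k) \<le> B * real (G k)"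
    using basis_means_bounded[OF basis add jump q ratio] by blast
  have "F 0 = 0"
    using greedy_additive_zero[OF basis add] .
  then have "0 \<le> F n" for n
    using monoD[OF mono, of 0 n] by simp
  then have "convergent (\<lambda>i. F (G i) / real (G i))"
    using B Gpos
    by (intro convergent_if_lower_bounds_improve[of 0 _ B]
          lower_bounds_improve[OF basis add mono q ratio]) (auto simp: field_simps)
  then show ?thesis
    using mean_tendsto_of_basis_tendsto[OF basis add] by (auto simp: convergent_def)
qed

section \<open>Exponential numeration systems\<close>

lemma exponential_ratio_bounded:
  assumes "exponential G"
  obtains q where "0 < q" "q < 1"
    "\<forall>\<^sub>F k in sequentially. real (G k) \<le> q * real (G (Suc k))"
proof -
  obtain \<alpha> C :: real where \<alpha>: "\<alpha> > 1" and "C > 0"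
    and equiv: "(\<lambda>l. real (G l)) \<sim>[at_top] (\<lambda>l. C * \<alpha> ^ l)"
    using assms by (auto simp: exponential_def)
  have "(\<lambda>l. real (G l) / real (G (Suc l))) \<sim>[at_top] (\<lambda>l. C * \<alpha> ^ l / (C * \<alpha> ^ Suc l))"
    using asymp_equiv_compose'[OF equiv filterlim_Suc] equiv by (intro asymp_equiv_divide) auto
  then have "(\<lambda>l. C * \<alpha> ^ l / (C * \<alpha> ^ Suc l)) \<sim>[at_top] (\<lambda>l. real (G l) / real (G (Suc l)))"
    by (rule asymp_equiv_symI)
  moreover have "(\<lambda>l. C * \<alpha> ^ l / (C * \<alpha> ^ Suc l)) \<longlonglongrightarrow> 1 / \<alpha>"
    using \<alpha> \<open>C > 0\<close> by simp
  ultimately have lim: "(\<lambda>l. real (G l) / real (G (Suc l))) \<longlonglongrightarrow> 1 / \<alpha>"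
    by (rule asymp_equiv_tendsto_transfer)
  obtain q where q: "1 / \<alpha> < q" "q < 1"
    using dense[of "1 / \<alpha>" 1] \<alpha> by auto
  have "0 < 1 / \<alpha>"
    using \<alpha> by simp
  then have "0 < q"
    using q(1) by linarith
  have nz: "\<forall>\<^sub>F k in sequentially. G (Suc k) \<noteq> 0"
  proof -
    have "\<forall>\<^sub>F k in sequentially. 0 < real (G k) / real (G (Suc k))"
      using order_tendstoD(1)[OF lim \<open>0 < 1 / \<alpha>\<close>] .
    then show ?thesis
      by (rule eventually_mono) (auto intro!: gr0I)
  qed
  have "\<forall>\<^sub>F k in sequentially. real (G k) / real (G (Suc k)) < q"
    using order_tendstoD(2)[OF lim q(1)] .
  then have "\<forall>\<^sub>F k in sequentially. real (G k) \<le> q * real (G (Suc k))"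
    using nz by eventually_elim (simp add: field_simps)
  then show thesis
    using that \<open>0 < q\<close> q(2) by blast
qed

theorem corollary5p18:
  fixes G :: "nat \<Rightarrow> nat"
  assumes "gns_basis G" and "exponential G"
  shows "\<exists>c. has_carry_propagation G c"
proof -
  let ?F = "\<lambda>N. \<Sum>i<N. real (cp G i)"
  obtain q where q: "0 < q" "q < 1"
    and ratio: "\<forall>\<^sub>F k in sequentially. real (G k) \<le> q * real (G (Suc k))"
    using exponential_ratio_bounded[OF assms(2)] .
  have mono: "mono ?F"
    by (intro monoI sum_mono2) auto
  have "?F (G k) \<le> ?F (G k - 1) + real (Suc k)" for k
  proof -
    obtain n where n: "G k = Suc n"
      using basis_pos[OF assms(1), of k] gr0_implies_Suc by blast
    have "cp G n = Suc k"
      using assms(1) n[symmetric]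
      by (intro cp_block_end) (auto simp: gns_basis_def strict_mono_def)
    then show ?thesis
      by (simp add: n)
  qed
  then have "convergent (\<lambda>N. ?F N / real N)"
    using mean_converges_if_ratio_bounded[OF assms(1) greedy_additive_sum_cp[OF assms(1)] mono _ q ratio]
    by blast
  then show ?thesis
    by (auto simp: has_carry_propagation_def convergent_def)
qed

end
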